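(* Let $\epsilon_1,\epsilon_2>0$ with $e^{\epsilon_1}>1+\epsilon_2$, and for an input $z$ and a model $\theta$ with confidence $p=\Pr[z|\theta]\in(0,1)$ let $$\tilde r(z;\theta)=-\log\bigl(\epsilon_1-\log(p+\epsilon_2)\bigr)$$ be the Bounded GumbelMap response. For any input $z$, and any model $\theta$, the response $\tilde r(z;\theta)$ is bounded. Let $\Theta$ be the set of OUT models. The mean and variance of the Bounded GumbelMap responses for all $\theta\in\Theta$ and all examples are both bounded.
   Context: $\log$ is the natural logarithm. A classification model $\theta$ gives, for an example (input) $z=(x,y)$ consisting of a query $x$ and its label $y$, a Softmax confidence $p=\Pr[z|\theta]=\Pr[Y=y\mid X=x;\theta]$, with $0<p<1$. An OUT model is a pre-trained shadow model whose training data does not include the queried example. *)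

theory Defs
  imports "HOL-Probability.Probability"
begin

(* Only the conditional label distribution Pr[Y = y | X = x; \<theta>] and the training data of a
   classifier are relevant here; the architecture and the parameters are abstracted away. *)
datatype ('x, 'y) model =
  Model (predict: "'x \<Rightarrow> 'y pmf") (training_data: "('x \<times> 'y) set")

definition confidence :: "('x, 'y) model \<Rightarrow> 'x \<times> 'y \<Rightarrow> real" where
  "confidence \<theta> z = pmf (predict \<theta> (fst z)) (snd z)"

definition bounded_gumbel_map ::
    "real \<Rightarrow> real \<Rightarrow> ('x, 'y) model \<Rightarrow> 'x \<times> 'y \<Rightarrow> real" where
  "bounded_gumbel_map \<epsilon>1 \<epsilon>2 \<theta> z = - ln (\<epsilon>1 - ln (confidence \<theta> z + \<epsilon>2))"

(* S is the collection of pre-trained shadow models, z the queried example. *)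
definition out_models :: "('x, 'y) model set \<Rightarrow> 'x \<times> 'y \<Rightarrow> ('x, 'y) model set" where
  "out_models S z = {\<theta> \<in> S. z \<notin> training_data \<theta>}"

(* Q is a law for drawing an OUT model for the fixed example z. The plain average over a finite
   set of OUT models is the case of the uniform law; see out_law_uniform below. *)
definition out_law ::
    "('x, 'y) model set \<Rightarrow> 'x \<times> 'y \<Rightarrow> ('x, 'y) model measure \<Rightarrow> bool" where
  "out_law S z Q \<longleftrightarrow>
     prob_space Q \<and>
     (\<lambda>\<theta>. confidence \<theta> z) \<in> borel_measurable Q \<and>
     (AE \<theta> in Q. \<theta> \<in> out_models S z \<and> confidence \<theta> z \<in> {0<..<1})"

(* The same when the example is drawn as well, for statistics pooled over examples and models. *)
definition pooled_out_law ::
    "('x, 'y) model set \<Rightarrow> (('x \<times> 'y) \<times> ('x, 'y) model) measure \<Rightarrow> bool" where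
  "pooled_out_law S M \<longleftrightarrow>
     prob_space M \<and>
     (\<lambda>(z, \<theta>). confidence \<theta> z) \<in> borel_measurable M \<and>
     (AE (z, \<theta>) in M. \<theta> \<in> out_models S z \<and> confidence \<theta> z \<in> {0<..<1})"

lemma out_law_uniform:
  assumes "finite (out_models S z)" "out_models S z \<noteq> {}"
    and "\<And>\<theta>. \<theta> \<in> out_models S z \<Longrightarrow> confidence \<theta> z \<in> {0<..<1}"
  shows "out_law S z (uniform_count_measure (out_models S z))"
    and "prob_space.expectation (uniform_count_measure (out_models S z)) f =
           (\<Sum>\<theta>\<in>out_models S z. f \<theta>) / card (out_models S z)"
proof -
  show "out_law S z (uniform_count_measure (out_models S z))"
    unfolding out_law_def
    using assms
    by (auto intro!: prob_space_uniform_count_measure AE_I2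
        simp: space_uniform_count_measure measurable_def sets_uniform_count_measure)
  show "prob_space.expectation (uniform_count_measure (out_models S z)) f =
           (\<Sum>\<theta>\<in>out_models S z. f \<theta>) / card (out_models S z)"
    using assms by (simp add: integral_uniform_count_measure)
qed

end

theory Submission
  imports Defs
begin

text \<open>For a confidence \<open>p\<close> strictly between 0 and 1, the argument of the outer
  logarithm, \<open>\<epsilon>1 - ln (p + \<epsilon>2)\<close>, lies between
  \<open>\<epsilon>1 - ln (1 + \<epsilon>2)\<close> and \<open>\<epsilon>1 - ln \<epsilon>2\<close>.
  The lower end is positive exactly because \<open>exp \<epsilon>1 > 1 + \<epsilon>2\<close>, so the
  argument stays in a compact subset of the positive reals, on which \<open>ln\<close> is bounded.
  This gives a constant \<open>C\<close> depending on \<epsilon>1 and \<epsilon>2 alone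
  (\<open>bounded_gumbel_map_bound\<close>). A random variable that is almost surely at most
  \<open>C\<close> in absolute value has mean at most \<open>C\<close> in absolute value and
  variance at most the square of \<open>C\<close> (\<open>moments_of_AE_bounded\<close>). Since
  \<open>C\<close> does not depend on the example, the model or the law, the bounds are uniform over
  all of them.\<close>

lemma abs_ln_le_max:
  fixes a b u :: real
  assumes "0 < a" "a \<le> u" "u \<le> b"
  shows "\<bar>ln u\<bar> \<le> max \<bar>ln a\<bar> \<bar>ln b\<bar>"
proof -
  have "ln a \<le> ln u" "ln u \<le> ln b"
    using assms by auto
  then show ?thesis
    by linarith
qed

text \<open>The two entries of the maximum come from the limiting confidences 1 and 0; between them
  the response is monotone in the confidence.\<close>

lemma bounded_gumbel_map_bound:
  assumes "\<epsilon>2 > 0" "exp \<epsilon>1 > 1 + \<epsilon>2" "confidence \<theta> z \<in> {0<..<1}"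
  shows "\<bar>bounded_gumbel_map \<epsilon>1 \<epsilon>2 \<theta> z\<bar> \<le> max \<bar>ln (\<epsilon>1 - ln (1 + \<epsilon>2))\<bar> \<bar>ln (\<epsilon>1 - ln \<epsilon>2)\<bar>"
proof -
  \<comment> \<open>This keeps the left end of the interval away from the singularity of
    \<open>ln\<close> at 0.\<close>
  have "ln (1 + \<epsilon>2) < \<epsilon>1"
    using assms by (metis add_pos_pos ln_exp ln_less_cancel_iff exp_gt_zero zero_less_one)
  moreover have "ln (confidence \<theta> z + \<epsilon>2) \<le> ln (1 + \<epsilon>2)" "ln \<epsilon>2 \<le> ln (confidence \<theta> z + \<epsilon>2)"
    using assms by auto
  ultimately show ?thesis
    unfolding bounded_gumbel_map_def abs_minus_cancel by (intro abs_ln_le_max) auto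
qed

text \<open>An almost sure bound is the right hypothesis, because the laws of OUT models constrain
  the confidence only almost everywhere. Integrability is part of the conclusion so that mean and
  variance are genuine moments and not the default value 0 of the integral.\<close>

lemma (in prob_space) moments_of_AE_bounded:
  fixes f :: "'a \<Rightarrow> real"
  assumes [measurable]: "f \<in> borel_measurable M" and bound: "AE x in M. \<bar>f x\<bar> \<le> C"
  shows "integrable M f" "integrable M (\<lambda>x. (f x)\<^sup>2)"
    and "\<bar>expectation f\<bar> \<le> C" "\<bar>variance f\<bar> \<le> C\<^sup>2"
proof -
  have sq: "AE x in M. (f x)\<^sup>2 \<le> C\<^sup>2"
    using bound by eventually_elim (metis abs_ge_zero power2_abs power_mono)
  show int: "integrable M f"
    using bound by (intro integrable_const_bound[where B = C]) auto
  show int2: "integrable M (\<lambda>x. (f x)\<^sup>2)"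
    using sq by (intro integrable_const_bound[where B = "C\<^sup>2"]) auto
  have "expectation f \<le> C"
    using bound by (intro integral_le_const int) auto
  moreover have "- C \<le> expectation f"
    using bound by (intro integral_ge_const int) auto
  ultimately show "\<bar>expectation f\<bar> \<le> C"
    by linarith
  \<comment> \<open>The variance is the second moment minus the square of the mean; the subtracted
    term is nonnegative.\<close>
  have "variance f \<le> expectation (\<lambda>x. (f x)\<^sup>2)"
    using variance_eq[OF int int2] by simp
  also have "\<dots> \<le> C\<^sup>2"
    by (intro integral_le_const int2 sq)
  finally show "\<bar>variance f\<bar> \<le> C\<^sup>2"
    using variance_positive[of f] by simp
qed

theorem lemma1:
  fixes \<epsilon>1 \<epsilon>2 :: real and S :: "('x, 'y) model set"
  assumes "\<epsilon>1 > 0" and "\<epsilon>2 > 0" and "exp \<epsilon>1 > 1 + \<epsilon>2"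
  shows "bounded {bounded_gumbel_map \<epsilon>1 \<epsilon>2 \<theta> z | (\<theta> :: ('x, 'y) model) z.
                    confidence \<theta> z \<in> {0<..<1}} \<and>
         (\<forall>z Q. out_law S z Q \<longrightarrow>
            integrable Q (\<lambda>\<theta>. bounded_gumbel_map \<epsilon>1 \<epsilon>2 \<theta> z) \<and>
            integrable Q (\<lambda>\<theta>. (bounded_gumbel_map \<epsilon>1 \<epsilon>2 \<theta> z)\<^sup>2)) \<and>
         bounded {prob_space.expectation Q (\<lambda>\<theta>. bounded_gumbel_map \<epsilon>1 \<epsilon>2 \<theta> z) | z Q.
                    out_law S z Q} \<and>
         bounded {prob_space.variance Q (\<lambda>\<theta>. bounded_gumbel_map \<epsilon>1 \<epsilon>2 \<theta> z) | z Q.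
                    out_law S z Q} \<and>
         (\<forall>M. pooled_out_law S M \<longrightarrow>
            integrable M (\<lambda>(z, \<theta>). bounded_gumbel_map \<epsilon>1 \<epsilon>2 \<theta> z) \<and>
            integrable M (\<lambda>(z, \<theta>). (bounded_gumbel_map \<epsilon>1 \<epsilon>2 \<theta> z)\<^sup>2)) \<and>
         bounded {prob_space.expectation M (\<lambda>(z, \<theta>). bounded_gumbel_map \<epsilon>1 \<epsilon>2 \<theta> z) | M.
                    pooled_out_law S M} \<and>
         bounded {prob_space.variance M (\<lambda>(z, \<theta>). bounded_gumbel_map \<epsilon>1 \<epsilon>2 \<theta> z) | M.
                    pooled_out_law S M}"
proof -
  define C where "C = max \<bar>ln (\<epsilon>1 - ln (1 + \<epsilon>2))\<bar> \<bar>ln (\<epsilon>1 - ln \<epsilon>2)\<bar>"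
  have bound: "\<bar>bounded_gumbel_map \<epsilon>1 \<epsilon>2 \<theta> z\<bar> \<le> C"
    if "confidence \<theta> z \<in> {0<..<1}" for \<theta> :: "('x, 'y) model" and z
    unfolding C_def using assms(2,3) that by (rule bounded_gumbel_map_bound)
  have Q: "integrable Q (\<lambda>\<theta>. bounded_gumbel_map \<epsilon>1 \<epsilon>2 \<theta> z)"
      "integrable Q (\<lambda>\<theta>. (bounded_gumbel_map \<epsilon>1 \<epsilon>2 \<theta> z)\<^sup>2)"
      "\<bar>prob_space.expectation Q (\<lambda>\<theta>. bounded_gumbel_map \<epsilon>1 \<epsilon>2 \<theta> z)\<bar> \<le> C"
      "\<bar>prob_space.variance Q (\<lambda>\<theta>. bounded_gumbel_map \<epsilon>1 \<epsilon>2 \<theta> z)\<bar> \<le> C\<^sup>2"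
    if "out_law S z Q" for z Q
  proof -
    have [measurable]: "(\<lambda>\<theta>. confidence \<theta> z) \<in> borel_measurable Q"
      and ae: "AE \<theta> in Q. \<theta> \<in> out_models S z \<and> confidence \<theta> z \<in> {0<..<1}"
      and Q: "prob_space Q"
      using that by (auto simp: out_law_def)
    have "(\<lambda>\<theta>. bounded_gumbel_map \<epsilon>1 \<epsilon>2 \<theta> z) \<in> borel_measurable Q"
      unfolding bounded_gumbel_map_def by measurable
    moreover have "AE \<theta> in Q. \<bar>bounded_gumbel_map \<epsilon>1 \<epsilon>2 \<theta> z\<bar> \<le> C"
      using ae by eventually_elim (blast intro: bound)
    ultimately show "integrable Q (\<lambda>\<theta>. bounded_gumbel_map \<epsilon>1 \<epsilon>2 \<theta> z)"
      "integrable Q (\<lambda>\<theta>. (bounded_gumbel_map \<epsilon>1 \<epsilon>2 \<theta> z)\<^sup>2)"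
      "\<bar>prob_space.expectation Q (\<lambda>\<theta>. bounded_gumbel_map \<epsilon>1 \<epsilon>2 \<theta> z)\<bar> \<le> C"
      "\<bar>prob_space.variance Q (\<lambda>\<theta>. bounded_gumbel_map \<epsilon>1 \<epsilon>2 \<theta> z)\<bar> \<le> C\<^sup>2"
      by (fact prob_space.moments_of_AE_bounded[OF Q])+
  qed
  have M: "integrable M (\<lambda>(z, \<theta>). bounded_gumbel_map \<epsilon>1 \<epsilon>2 \<theta> z)"
      "integrable M (\<lambda>(z, \<theta>). (bounded_gumbel_map \<epsilon>1 \<epsilon>2 \<theta> z)\<^sup>2)"
      "\<bar>prob_space.expectation M (\<lambda>(z, \<theta>). bounded_gumbel_map \<epsilon>1 \<epsilon>2 \<theta> z)\<bar> \<le> C"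
      "\<bar>prob_space.variance M (\<lambda>(z, \<theta>). bounded_gumbel_map \<epsilon>1 \<epsilon>2 \<theta> z)\<bar> \<le> C\<^sup>2"
    if "pooled_out_law S M" for M
  proof -
    \<comment> \<open>Pairs are handled through projections, so that the pooled response is a
      function of a single variable \<open>w\<close>, as the moment lemma expects.\<close>
    have [measurable]: "(\<lambda>w. confidence (snd w) (fst w)) \<in> borel_measurable M"
      and ae: "AE w in M. snd w \<in> out_models S (fst w) \<and> confidence (snd w) (fst w) \<in> {0<..<1}"
      and M: "prob_space M"
      using that by (auto simp: pooled_out_law_def case_prod_unfold)
    have "(\<lambda>w. bounded_gumbel_map \<epsilon>1 \<epsilon>2 (snd w) (fst w)) \<in> borel_measurable M"
      unfolding bounded_gumbel_map_def by measurable
    moreover have "AE w in M. \<bar>bounded_gumbel_map \<epsilon>1 \<epsilon>2 (snd w) (fst w)\<bar> \<le> C"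
      using ae by eventually_elim (blast intro: bound)
    ultimately show "integrable M (\<lambda>(z, \<theta>). bounded_gumbel_map \<epsilon>1 \<epsilon>2 \<theta> z)"
      "integrable M (\<lambda>(z, \<theta>). (bounded_gumbel_map \<epsilon>1 \<epsilon>2 \<theta> z)\<^sup>2)"
      "\<bar>prob_space.expectation M (\<lambda>(z, \<theta>). bounded_gumbel_map \<epsilon>1 \<epsilon>2 \<theta> z)\<bar> \<le> C"
      "\<bar>prob_space.variance M (\<lambda>(z, \<theta>). bounded_gumbel_map \<epsilon>1 \<epsilon>2 \<theta> z)\<bar> \<le> C\<^sup>2"
      unfolding case_prod_unfold by (fact prob_space.moments_of_AE_bounded[OF M])+
  qed
  show ?thesis
    using bound Q M
    \<comment> \<open>Each boundedness claim asks for one real bound on a whole set: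
      \<open>C\<close> serves for responses and means, \<open>C\<^sup>2\<close> for
      variances.\<close>
    by (intro conjI allI impI; (simp; fail)?; unfold bounded_real; blast)
qed

end
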